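(* Let $X=Y=\mathbb{R}^d$ for $d\in\mathbb{N}$ and consider a cost function $c\colon\mathbb{R}^d\times\mathbb{R}^d\to\mathbb{R}_+$ of the form $c(x,y)=h(x-y)$ for a continuous function $h\colon\mathbb{R}^d\to\mathbb{R}_+$. Assume: (C) There exist a height $s>0$ and an angle $\vartheta\in(0,\pi)$ such that each $p\in\mathbb{R}^d$ far enough from the origin admits a direction $u\in\mathbb{R}^d$, $\|u\|=1$, for which $h(p)\ge h(p+q)$ for all $q\in K_u$, where $K_u=\{q\in\mathbb{R}^d\mid \sphericalangle(u,q)\le\vartheta/2,\ \langle u,q\rangle\le s\}$ and $\sphericalangle\colon\mathbb{R}^d\times\mathbb{R}^d\to[0,\pi]$ denotes the angle between two vectors. (G) Each $x\in\mathbb{R}^d$ admits $\delta_x\in\mathbb{R}^d$ such that $h(x)-h(x+\delta_x)\to\infty$ and $\delta_x\to0$ as $\|x\|\to\infty$. Then, for any $\mu,\nu\in\mathcal{P}(\mathbb{R}^d)$ with $T_c(\mu,\nu)<\infty$ and any optimal transport plan $\pi\in\mathcal{C}(\mu,\nu)$, $$\Sigma_\pi\subset\partial\,\mathrm{supp}\,\mu .$$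
   Context: $\mathcal{P}(X)$ is the set of Borel probability measures; $\mathcal{C}(\mu,\nu)$ is the set of probability measures on $X\times Y$ with marginals $\mu,\nu$; $T_c(\mu,\nu)=\inf_{\pi\in\mathcal{C}(\mu,\nu)}\int c\,\mathrm{d}\pi$, and $\pi$ is optimal if it attains the infimum. $\mathrm{supp}$ is the smallest closed set of full measure, $\partial A=\mathrm{cl}(A)\setminus\mathrm{int}(A)$, and $p_X\colon X\times Y\to X$ is the projection. A plan $\pi\in\mathcal{C}(\mu,\nu)$ induces regularity on a relatively open set $U\subset\mathrm{supp}\,\mu$ if there is a compact $K\subset\mathrm{supp}\,\nu$ with $p_X(\mathrm{supp}\,\pi)\cap U=p_X\big(\mathrm{supp}\,\pi\cap(U\times K)\big)$. It induces regularity at $x\in\mathrm{supp}\,\mu$ if it induces regularity on some relatively open neighborhood $U\subset\mathrm{supp}\,\mu$ of $x$. Finally, $\Sigma_\pi=\{x\in\mathrm{supp}\,\mu\mid\pi\text{ does not induce regularity at }x\}$. *)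

theory Defs
  imports "HOL-Probability.Probability"
begin

section \<open>Couplings and optimal transport\<close>

definition borel_probs :: "'a::topological_space measure set" where
  "borel_probs = {M. sets M = sets borel \<and> prob_space M}"

definition couplings ::
  "'a::topological_space measure \<Rightarrow> 'b::topological_space measure \<Rightarrow> ('a \<times> 'b) measure set" where
  "couplings \<mu> \<nu> =
     {\<pi> \<in> borel_probs. distr \<pi> borel fst = \<mu> \<and> distr \<pi> borel snd = \<nu>}"

text \<open>Cost functions are real-valued and meant to be nonnegative (the coercion to
  extended nonnegative reals truncates negative values); the transport cost may be infinite.\<close>

definition plan_cost :: "('a \<times> 'b \<Rightarrow> real) \<Rightarrow> ('a \<times> 'b) measure \<Rightarrow> ennreal" where
  "plan_cost c \<pi> = (\<integral>\<^sup>+ z. ennreal (c z) \<partial>\<pi>)"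

definition transport_cost ::
  "('a::topological_space \<times> 'b::topological_space \<Rightarrow> real) \<Rightarrow> 'a measure \<Rightarrow> 'b measure \<Rightarrow> ennreal" where
  "transport_cost c \<mu> \<nu> = (INF \<pi>\<in>couplings \<mu> \<nu>. plan_cost c \<pi>)"

definition optimal_plan ::
  "('a::topological_space \<times> 'b::topological_space \<Rightarrow> real) \<Rightarrow> 'a measure \<Rightarrow> 'b measure
    \<Rightarrow> ('a \<times> 'b) measure \<Rightarrow> bool" where
  "optimal_plan c \<mu> \<nu> \<pi> \<longleftrightarrow> \<pi> \<in> couplings \<mu> \<nu> \<and> plan_cost c \<pi> = transport_cost c \<mu> \<nu>"


section \<open>Support of a measure\<close>

text \<open>The intersection of all closed sets of full measure. On second countable spaces it has
  full measure itself, so it is the smallest such set.\<close>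

definition supp :: "'a::topological_space measure \<Rightarrow> 'a set" where
  "supp M = \<Inter>{C. closed C \<and> emeasure M C = emeasure M (space M)}"

lemma closed_supp: "closed (supp M)"
  unfolding supp_def by (rule closed_Inter) auto

lemma supp_minimal:
  "closed C \<Longrightarrow> emeasure M C = emeasure M (space M) \<Longrightarrow> supp M \<subseteq> C"
  unfolding supp_def by auto

lemma emeasure_supp:
  fixes M :: "'a::second_countable_topology measure"
  assumes M: "M \<in> borel_probs"
  shows "emeasure M (supp M) = emeasure M (space M)"
proof -
  have sets_M: "sets M = sets borel" and "prob_space M" using M by (simp_all add: borel_probs_def)
  interpret prob_space M by fact
  have space_M: "space M = UNIV" using sets_eq_imp_space_eq[OF sets_M] by simp
  define F where "F = {U. open U \<and> emeasure M (- U) = emeasure M (space M)}"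
  have null: "U \<in> null_sets M" if "U \<in> F" for U
  proof
    show U: "U \<in> sets M" using that unfolding F_def sets_M by (intro borel_open) blast
    have "space M - U = - U" unfolding space_M by blast
    then have "emeasure M (space M - U) = 1"
      using that emeasure_space_1 unfolding F_def by simp
    then have "prob (space M - U) = 1" unfolding measure_def by simp
    then have "prob U = 0" using prob_compl[OF U] by linarith
    then show "emeasure M U = 0" unfolding emeasure_eq_measure by simp
  qed
  have "open U" if "U \<in> F" for U using that unfolding F_def by blast
  then obtain F' where F': "F' \<subseteq> F" "countable F'" "\<Union>F' = \<Union>F"
    by (rule Lindelof)
  have "(\<Union>U\<in>F'. U) \<in> null_sets M"
    using F'(1) null by (intro null_sets_UN' F'(2)) blast
  then have N: "\<Union>F \<in> null_sets M" unfolding image_ident F'(3) .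
  have "supp M = space M - \<Union>F"
  proof (intro equalityI subsetI)
    fix x assume x: "x \<in> supp M"
    have "x \<notin> U" if "U \<in> F" for U
    proof -
      from that have "closed (- U)" "emeasure M (- U) = emeasure M (space M)"
        unfolding F_def by (simp_all add: closed_Compl)
      from supp_minimal[OF this] x show ?thesis by blast
    qed
    then show "x \<in> space M - \<Union>F" unfolding space_M by blast
  next
    fix x assume x: "x \<in> space M - \<Union>F"
    show "x \<in> supp M" unfolding supp_def
    proof (rule InterI)
      fix C assume "C \<in> {C. closed C \<and> emeasure M C = emeasure M (space M)}"
      then have "- C \<in> F" unfolding F_def by (simp add: open_Compl)
      with x show "x \<in> C" by blast
    qed
  qed
  then show ?thesis using emeasure_Diff_null_set[OF N sets.top] by (rule ssubst)
qed


section \<open>Induced regularity\<close>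

definition induces_regularity_on ::
  "'a::topological_space measure \<Rightarrow> 'b::topological_space measure \<Rightarrow> ('a \<times> 'b) measure \<Rightarrow> 'a set \<Rightarrow> bool" where
  "induces_regularity_on \<mu> \<nu> \<pi> U \<longleftrightarrow>
     openin (top_of_set (supp \<mu>)) U \<and>
     (\<exists>K. compact K \<and> K \<subseteq> supp \<nu> \<and> fst ` supp \<pi> \<inter> U = fst ` (supp \<pi> \<inter> (U \<times> K)))"

definition induces_regularity_at ::
  "'a::topological_space measure \<Rightarrow> 'b::topological_space measure \<Rightarrow> ('a \<times> 'b) measure \<Rightarrow> 'a \<Rightarrow> bool" where
  "induces_regularity_at \<mu> \<nu> \<pi> x \<longleftrightarrow> (\<exists>U. x \<in> U \<and> induces_regularity_on \<mu> \<nu> \<pi> U)"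

definition singular_points ::
  "'a::topological_space measure \<Rightarrow> 'b::topological_space measure \<Rightarrow> ('a \<times> 'b) measure \<Rightarrow> 'a set" where
  "singular_points \<mu> \<nu> \<pi> = {x \<in> supp \<mu>. \<not> induces_regularity_at \<mu> \<nu> \<pi> x}"


section \<open>Truncated cones\<close>

text \<open>By the convention that division by zero yields zero, the angle with the zero vector is
  \<open>pi / 2\<close>. So for \<open>\<theta> < pi\<close> the truncated cone below does not contain its apex, which is
  immaterial for conditions of the form \<open>h p \<ge> h (p + q)\<close>.\<close>

definition vec_angle :: "'a::real_inner \<Rightarrow> 'a \<Rightarrow> real" where
  "vec_angle u v = arccos (u \<bullet> v / (norm u * norm v))"

definition truncated_cone :: "real \<Rightarrow> real \<Rightarrow> 'a::real_inner \<Rightarrow> 'a set" where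
  "truncated_cone s \<theta> u = {q. vec_angle u q \<le> \<theta> / 2 \<and> u \<bullet> q \<le> s}"

end

theory Submission
  imports Defs
begin

text \<open>A singular point \<open>x\<close> is approached by points \<open>X n\<close> whose partners \<open>Y n\<close> in the support of
  the plan escape to infinity. If \<open>x\<close> is interior to the support of \<open>\<mu>\<close>, condition (G) at
  \<open>p = X n - Y n\<close> followed by condition (C) at \<open>p + \<delta> p\<close> gives an unbounded gain
  \<open>h (X n - Y n) - h (x' - Y n)\<close>, where \<open>x'\<close> ranges over a cone near \<open>x\<close> and, passing to a subsequence
  along which the directions of the cones converge, can be chosen independently of \<open>n\<close> and with a
  partner \<open>y'\<close>. But cyclical monotonicity bounds this gain by \<open>h (X n - y') - h (x' - y')\<close>,
  which converges.\<close>

section \<open>Monotonicity of the support of an optimal plan\<close>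

lemma not_in_suppI:
  fixes M :: "'a::topological_space measure"
  assumes M: "M \<in> borel_probs" and "open U" "x \<in> U" and 0: "emeasure M U = 0"
  shows "x \<notin> supp M"
proof -
  have sets: "sets M = sets borel" and "prob_space M" using M by (simp_all add: borel_probs_def)
  interpret prob_space M by fact
  have sp: "space M = UNIV" using sets_eq_imp_space_eq[OF sets] by simp
  have "U \<in> null_sets M" using \<open>open U\<close> 0 sets by auto
  then have "emeasure M (space M - U) = emeasure M (space M)"
    by (intro emeasure_Diff_null_set) auto
  then have "supp M \<subseteq> - U"
    using \<open>open U\<close> by (intro supp_minimal) (auto simp: sp Compl_eq_Diff_UNIV)
  with \<open>x \<in> U\<close> show ?thesis by blast
qed

text \<open>Draw two independent samples of the plan and exchange their partners whenever this is
  strictly cheaper. As this rule is symmetric in the two samples, the first resulting pair is again a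
  coupling, and by optimality the exchange almost surely never happens.\<close>

lemma optimal_plan_supp_monotone:
  fixes c :: "'a::second_countable_topology \<times> 'b::second_countable_topology \<Rightarrow> real"
  assumes nonneg: "\<And>z. 0 \<le> c z"
    and cont: "continuous_on UNIV c"
    and finite: "transport_cost c \<mu> \<nu> < \<infinity>"
    and opt: "optimal_plan c \<mu> \<nu> \<pi>"
    and supp: "(x, y) \<in> supp \<pi>" "(x', y') \<in> supp \<pi>"
  shows "c (x, y) + c (x', y') \<le> c (x, y') + c (x', y)"
proof -
  have \<pi>: "\<pi> \<in> borel_probs" "distr \<pi> borel fst = \<mu>" "distr \<pi> borel snd = \<nu>"
    and opt_cost: "plan_cost c \<pi> = transport_cost c \<mu> \<nu>"
    using opt by (auto simp: optimal_plan_def couplings_def)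
  have sets_\<pi>[measurable_cong]: "sets \<pi> = sets borel" and "prob_space \<pi>"
    using \<pi> by (simp_all add: borel_probs_def)
  interpret prob_space \<pi> by fact
  interpret PP: pair_prob_space \<pi> \<pi> ..
  have space_\<pi>: "space \<pi> = UNIV" using sets_eq_imp_space_eq[OF sets_\<pi>] by simp
  have c_m[measurable]: "c \<in> borel_measurable borel" using cont by (rule borel_measurable_continuous_onI)
  have fst_m[measurable]: "fst \<in> \<pi> \<rightarrow>\<^sub>M borel"
    unfolding measurable_cong_sets[OF sets_\<pi> refl] by (intro borel_measurable_continuous_onI continuous_intros)
  have snd_m[measurable]: "snd \<in> \<pi> \<rightarrow>\<^sub>M borel"
    unfolding measurable_cong_sets[OF sets_\<pi> refl] by (intro borel_measurable_continuous_onI continuous_intros)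
  define P where "P = \<pi> \<Otimes>\<^sub>M \<pi>"
  have sets_P[measurable_cong]: "sets P = sets (borel \<Otimes>\<^sub>M borel)"
    unfolding P_def by (intro sets_pair_measure_cong sets_\<pi>)
  have P_swap: "(\<integral>\<^sup>+ (z, z'). f (z', z) \<partial>P) = (\<integral>\<^sup>+ w. f w \<partial>P)" if "f \<in> borel_measurable P" for f
  proof -
    have "(\<integral>\<^sup>+ w. f w \<partial>P) = (\<integral>\<^sup>+ w. f w \<partial>distr P P (\<lambda>(z, z'). (z', z)))"
      using PP.distr_pair_swap by (simp add: P_def)
    also have "\<dots> = (\<integral>\<^sup>+ w. f (case w of (z, z') \<Rightarrow> (z', z)) \<partial>P)"
      using that by (intro nn_integral_distr) (auto simp: P_def measurable_pair_swap')
    finally show ?thesis by (simp add: case_prod_unfold)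
  qed
  have P_fst: "(\<integral>\<^sup>+ (z, z'). f z \<partial>P) = (\<integral>\<^sup>+ z. f z \<partial>\<pi>)"
    if [measurable]: "f \<in> borel_measurable \<pi>" for f
  proof -
    have "(\<integral>\<^sup>+ z. f z \<partial>\<pi>) = (\<integral>\<^sup>+ z. (\<integral>\<^sup>+ z'. f (fst (z, z')) \<partial>\<pi>) \<partial>\<pi>)"
      by (simp add: emeasure_space_1)
    also have "\<dots> = (\<integral>\<^sup>+ w. f (fst w) \<partial>P)"
      unfolding P_def by (rule nn_integral_fst) measurable
    finally show ?thesis by (simp add: case_prod_unfold)
  qed
  have P_snd: "(\<integral>\<^sup>+ (z, z'). f z' \<partial>P) = (\<integral>\<^sup>+ z. f z \<partial>\<pi>)"
    if [measurable]: "f \<in> borel_measurable \<pi>" for f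
  proof -
    have "(\<lambda>(z, z'). f z) \<in> borel_measurable P" unfolding P_def by measurable
    from P_swap[OF this] P_fst[OF that] show ?thesis by simp
  qed
  define D where "D = {(z, z'). c (fst z, snd z') + c (fst z', snd z) < c z + c z'}"
  have D_sym: "(z', z) \<in> D \<longleftrightarrow> (z, z') \<in> D" for z z' by (auto simp: D_def add.commute)
  have D_open: "open D"
    unfolding D_def case_prod_unfold
    by (intro open_Collect_less continuous_intros continuous_on_compose2[OF cont]) auto
  have borelP: "sets P = sets borel" unfolding sets_P borel_prod ..
  have D_sets[measurable]: "D \<in> sets P" using D_open borelP by simp
  \<comment> \<open>\<open>F\<close> keeps only the first of the two pairs after the exchange. Since
    \<open>D\<close> is symmetric, the second pair is \<open>F (z', z)\<close>.\<close>
  define F where "F = (\<lambda>(z, z'). (fst z, if (z, z') \<in> D then snd z' else snd z))"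
  have F1: "(\<lambda>w. fst (fst w)) \<in> P \<rightarrow>\<^sub>M borel"
    unfolding P_def by measurable
  have F2: "(\<lambda>w. snd (fst w)) \<in> P \<rightarrow>\<^sub>M borel"
    unfolding P_def by measurable
  have F3: "(\<lambda>w. snd (snd w)) \<in> P \<rightarrow>\<^sub>M borel"
    unfolding P_def by measurable
  have F4: "(\<lambda>w. fst (snd w)) \<in> P \<rightarrow>\<^sub>M borel"
    unfolding P_def by measurable
  have F_m[measurable]: "F \<in> P \<rightarrow>\<^sub>M borel"
    unfolding F_def case_prod_unfold
    by (intro borel_measurable_Pair measurable_If F1 F2 F3)
      (use D_sets sets.sets_into_space in \<open>auto simp: Int_def[symmetric] Int_absorb1\<close>)
  \<comment> \<open>Swap invariance of \<open>P\<close> makes both new pairs equally distributed.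
    Doubling brings both under one integral, where quantities that the exchange merely permutes
    cancel out.\<close>
  have symm: "2 * (\<integral>\<^sup>+ z. f z \<partial>distr P borel F) = (\<integral>\<^sup>+ (z, z'). f (F (z, z')) + f (F (z', z)) \<partial>P)"
    if [measurable]: "f \<in> borel_measurable borel" for f
  proof -
    have m: "(\<lambda>w. f (F w)) \<in> borel_measurable P" by measurable
    have "(\<lambda>(z, z'). (z', z)) \<in> P \<rightarrow>\<^sub>M P" unfolding P_def by measurable
    with m have m': "(\<lambda>w. f (F (snd w, fst w))) \<in> borel_measurable P"
      unfolding case_prod_unfold by (rule measurable_compose[rotated])
    show ?thesis
      using P_swap[OF m] m m' by (simp add: nn_integral_distr nn_integral_add mult_2 case_prod_unfold)
  qed
  have cost_m: "(\<lambda>z. ennreal (c z)) \<in> borel_measurable borel" by measurable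
  have P_add: "(\<integral>\<^sup>+ (z, z'). f z + f z' \<partial>P) = 2 * (\<integral>\<^sup>+ z. f z \<partial>\<pi>)"
    if [measurable]: "f \<in> borel_measurable borel" for f :: "_ \<Rightarrow> ennreal"
  proof -
    have "f \<in> borel_measurable \<pi>" by measurable
    moreover have "(\<lambda>w. f (fst w)) \<in> borel_measurable P" "(\<lambda>w. f (snd w)) \<in> borel_measurable P"
      unfolding P_def by measurable
    ultimately show ?thesis
      using P_fst[of f] P_snd[of f] by (simp add: nn_integral_add mult_2 case_prod_unfold)
  qed
  have coupling: "distr P borel F \<in> couplings \<mu> \<nu>"
  proof -
    have "prob_space (distr P borel F)"
      unfolding P_def by (rule PP.prob_space_distr) (use F_m in \<open>simp add: P_def\<close>)
    moreover have "distr (distr P borel F) borel fst = \<mu>"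
    proof (rule measure_eqI)
      fix A assume "A \<in> sets (distr (distr P borel F) borel fst)"
      then have [measurable]: "A \<in> sets borel" by simp
      have A1: "(fst -` A :: ('a \<times> 'b) set) \<in> sets borel"
        using measurable_sets[OF fst_m, of A] space_\<pi> sets_\<pi> by simp
      have A2: "(F -` (fst -` A) \<inter> space P) \<in> sets P" using F_m A1 by (rule measurable_sets)
      have "emeasure (distr (distr P borel F) borel fst) A = emeasure (distr P borel F) (fst -` A)"
        using fst_m by (subst emeasure_distr) (simp_all add: measurable_cong_sets[OF sets_\<pi> refl])
      also have "\<dots> = (\<integral>\<^sup>+ w. indicator (fst -` A) (F w) \<partial>P)"
        using A1 A2 by (simp add: nn_integral_distr flip: nn_integral_indicator)
      also have "\<dots> = (\<integral>\<^sup>+ (z, z'). indicator (fst -` A) z \<partial>P)"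
        by (intro nn_integral_cong) (auto simp: F_def indicator_def)
      also have "\<dots> = emeasure \<pi> (fst -` A)"
        using A1 sets_\<pi> by (subst P_fst) auto
      also have "\<dots> = emeasure \<mu> A"
        unfolding \<pi>(2)[symmetric] using fst_m by (subst emeasure_distr) (simp_all add: space_\<pi>)
      finally show "emeasure (distr (distr P borel F) borel fst) A = emeasure \<mu> A" .
    qed (simp flip: \<pi>(2))
    moreover have "distr (distr P borel F) borel snd = \<nu>"
    proof (rule measure_eqI)
      fix A assume "A \<in> sets (distr (distr P borel F) borel snd)"
      then have [measurable]: "A \<in> sets borel" by simp
      have A1: "(snd -` A :: ('a \<times> 'b) set) \<in> sets borel"
        using measurable_sets[OF snd_m, of A] space_\<pi> sets_\<pi> by simp
      \<comment> \<open>The exchange permutes the two second coordinates, so it preserves the sum of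
        their indicators but not each indicator alone. Hence the factor 2, which the first marginal
        does without because \<open>F\<close> leaves the first coordinate unchanged.\<close>
      have "2 * emeasure (distr (distr P borel F) borel snd) A = 2 * emeasure (distr P borel F) (snd -` A)"
        using snd_m by (subst emeasure_distr) (simp_all add: measurable_cong_sets[OF sets_\<pi> refl])
      also have "\<dots> = 2 * (\<integral>\<^sup>+ z. indicator (snd -` A) z \<partial>distr P borel F)"
        using A1 by (subst nn_integral_indicator) auto
      also have "\<dots> = (\<integral>\<^sup>+ (z, z'). indicator (snd -` A) z + indicator (snd -` A) z' \<partial>P)"
        using A1 by (subst symm) (auto simp: F_def indicator_def D_sym intro!: nn_integral_cong)
      also have "\<dots> = 2 * emeasure \<pi> (snd -` A)"
        using A1 sets_\<pi> by (subst P_add) auto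
      also have "\<dots> = 2 * emeasure \<nu> A"
        unfolding \<pi>(3)[symmetric] using snd_m by (subst emeasure_distr) (simp_all add: space_\<pi>)
      finally show "emeasure (distr (distr P borel F) borel snd) A = emeasure \<nu> A"
        by (simp add: ennreal_mult_cancel_left)
    qed (simp flip: \<pi>(3))
    ultimately show ?thesis by (simp add: couplings_def borel_probs_def)
  qed
  \<comment> \<open>\<open>g\<close> is the saving made by the exchange: strictly positive on
    \<open>D\<close> and zero elsewhere.\<close>
  define g where "g = (\<lambda>(z, z').
    ennreal (c z + c z' - (c (fst z, snd z') + c (fst z', snd z))) * indicator D (z, z'))"
  have g_m: "g \<in> borel_measurable P"
  proof -
    have "(\<lambda>w. c (fst w)) \<in> borel_measurable P" "(\<lambda>w. c (snd w)) \<in> borel_measurable P"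
      unfolding P_def by measurable
    moreover have "(\<lambda>w. c (fst (fst w), snd (snd w))) \<in> borel_measurable P"
      "(\<lambda>w. c (fst (snd w), snd (fst w))) \<in> borel_measurable P"
      by (rule measurable_compose[OF borel_measurable_Pair c_m], rule F1 F2 F3 F4, rule F1 F2 F3 F4)+
    ultimately show ?thesis
      unfolding g_def case_prod_unfold by simp
  qed
  \<comment> \<open>Balance: the cost of the two new pairs plus the saving is the cost of the two
    samples.\<close>
  have "2 * plan_cost c (distr P borel F) + (\<integral>\<^sup>+ w. g w \<partial>P)
      = (\<integral>\<^sup>+ (z, z'). ennreal (c z) + ennreal (c z') \<partial>P)"
  proof -
    have m: "(\<lambda>w. ennreal (c (F w)) + ennreal (c (F (snd w, fst w)))) \<in> borel_measurable P"
    proof -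
      have "(\<lambda>w. (snd w, fst w)) \<in> P \<rightarrow>\<^sub>M P" unfolding P_def by measurable
      then have "(\<lambda>w. c (F (snd w, fst w))) \<in> borel_measurable P"
        by (rule measurable_compose) measurable
      then show ?thesis by measurable
    qed
    have "ennreal (c (F (z, z'))) + ennreal (c (F (z', z))) + g (z, z') = ennreal (c z) + ennreal (c z')"
      for z z'
      using nonneg D_sym[of z z']
      by (cases "(z, z') \<in> D") (auto simp: F_def g_def D_def simp flip: ennreal_plus)
    then have "(\<integral>\<^sup>+ (z, z'). ennreal (c z) + ennreal (c z') \<partial>P)
      = (\<integral>\<^sup>+ w. (ennreal (c (F w)) + ennreal (c (F (snd w, fst w)))) + g w \<partial>P)"
      by (intro nn_integral_cong) auto
    also have "\<dots> = (\<integral>\<^sup>+ w. ennreal (c (F w)) + ennreal (c (F (snd w, fst w))) \<partial>P) + (\<integral>\<^sup>+ w. g w \<partial>P)"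
      using m g_m by (rule nn_integral_add)
    also have "(\<integral>\<^sup>+ w. ennreal (c (F w)) + ennreal (c (F (snd w, fst w))) \<partial>P)
        = 2 * plan_cost c (distr P borel F)"
      unfolding plan_cost_def symm[OF cost_m] by (simp add: case_prod_unfold)
    finally show ?thesis by simp
  qed
  then have le: "2 * plan_cost c (distr P borel F) + (\<integral>\<^sup>+ w. g w \<partial>P) = 2 * plan_cost c \<pi>"
    by (simp add: P_add[OF cost_m] plan_cost_def)
  have fin: "plan_cost c \<pi> < \<infinity>" using finite opt_cost by simp
  have "plan_cost c \<pi> \<le> plan_cost c (distr P borel F)"
    unfolding opt_cost transport_cost_def using coupling by (rule INF_lower)
  then have "2 * plan_cost c \<pi> + (\<integral>\<^sup>+ w. g w \<partial>P) \<le> 2 * plan_cost c \<pi> + 0"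
    unfolding add_0_right by (subst (2) le[symmetric]) (intro add_mono mult_left_mono order_refl, auto)
  \<comment> \<open>Finiteness of the optimal cost permits cancelling it on both sides in
    \<open>ennreal\<close>.\<close>
  moreover have "2 * plan_cost c \<pi> \<noteq> top" using fin by (auto simp: ennreal_mult_eq_top_iff)
  ultimately have "(\<integral>\<^sup>+ w. g w \<partial>P) = 0"
    unfolding ennreal_add_left_cancel_le by simp
  then have "AE w in P. g w = 0" using nn_integral_0_iff_AE[OF g_m] by simp
  then have "AE w in P. w \<notin> D"
    by (rule AE_mp) (auto simp: g_def D_def indicator_def ennreal_eq_0_iff)
  then have D0: "emeasure P D = 0"
    using D_sets sets.sets_into_space[OF D_sets] by (subst (asm) AE_iff_measurable[of D]) auto
  show ?thesis
  proof (rule ccontr)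
    \<comment> \<open>A violation at two support points puts an open rectangle around them inside
      the null set \<open>D\<close>, although both of its sides have positive mass.\<close>
    assume "\<not> ?thesis"
    then have "((x, y), (x', y')) \<in> D" by (simp add: D_def)
    then obtain V V' where V: "open V" "open V'" "(x, y) \<in> V" "(x', y') \<in> V'" "V \<times> V' \<subseteq> D"
      using D_open open_prod_elim by (metis mem_Sigma_iff)
    have "emeasure \<pi> V * emeasure \<pi> V' = emeasure P (V \<times> V')"
      unfolding P_def using V sets_\<pi> by (intro emeasure_pair_measure_Times[symmetric]) auto
    also have "\<dots> \<le> emeasure P D" using V by (intro emeasure_mono) auto
    finally show False using D0 V supp not_in_suppI[OF \<pi>(1)] by auto
  qed
qed

section \<open>Balls inside truncated cones\<close>

text \<open>On the ball, \<open>u \<bullet> q > r - \<epsilon>\<close> and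
  \<open>norm q < r + \<epsilon>\<close>, so the cosine of the angle is at least
  \<open>(r - \<epsilon>) / (r + \<epsilon>)\<close>; \<open>\<epsilon>\<close> is chosen to make
  this \<open>cos (\<theta> / 2)\<close>. As \<open>r\<close> and \<open>\<epsilon>\<close> do not
  depend on \<open>u\<close>, the lemma can be applied along a convergent sequence of
  directions.\<close>

lemma truncated_cone_contains_ball:
  assumes s: "0 < s" and \<theta>: "0 < \<theta>" "\<theta> < pi" and R: "0 < R"
  obtains r \<epsilon> :: real where "0 < r" "r < R" "0 < \<epsilon>"
    "\<And>u :: 'a::real_inner. norm u = 1 \<Longrightarrow> ball (r *\<^sub>R u) \<epsilon> \<subseteq> truncated_cone s \<theta> u"
proof -
  define k where "k = cos (\<theta> / 2)"
  define r where "r = min s R / 2"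
  define \<epsilon> where "\<epsilon> = r * (1 - k) / (1 + k)"
  have k: "0 < k" "k < 1"
    using cos_gt_zero[of "\<theta> / 2"] cos_monotone_0_pi[of 0 "\<theta> / 2"] \<theta> by (simp_all add: k_def)
  \<comment> \<open>The last bound gives the height condition, since
    \<open>u \<bullet> q < r + \<epsilon> < 2 * r\<close>.\<close>
  have r: "0 < r" "r < R" "2 * r \<le> s" using s R by (auto simp: r_def min_def)
  have \<epsilon>: "0 < \<epsilon>" "\<epsilon> < r" using r k by (auto simp: \<epsilon>_def divide_simps algebra_simps)
  have \<epsilon>_eq: "r - \<epsilon> = k * (r + \<epsilon>)" using k by (simp add: \<epsilon>_def field_simps)
  have "ball (r *\<^sub>R u) \<epsilon> \<subseteq> truncated_cone s \<theta> u" if u: "norm u = 1" for u :: 'a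
  proof
    fix q assume "q \<in> ball (r *\<^sub>R u) \<epsilon>"
    then have q: "norm (q - r *\<^sub>R u) < \<epsilon>" by (simp add: dist_norm norm_minus_commute)
    have "\<bar>u \<bullet> (q - r *\<^sub>R u)\<bar> < \<epsilon>" using Cauchy_Schwarz_ineq2[of u "q - r *\<^sub>R u"] u q by simp
    moreover have "u \<bullet> u = 1" using u by (simp add: dot_square_norm)
    ultimately have uq: "\<bar>u \<bullet> q - r\<bar> < \<epsilon>" by (simp add: inner_diff_right)
    have "norm q \<le> norm (r *\<^sub>R u) + norm (q - r *\<^sub>R u)" by (rule norm_triangle_sub)
    then have nq: "norm q \<le> r + \<epsilon>" using q u r by simp
    \<comment> \<open>\<open>\<epsilon> < r\<close> keeps the ball away from the origin, where
      \<open>vec_angle\<close> has only a conventional value.\<close>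
    have "0 < norm q" using uq \<epsilon> by auto
    have "k * norm q \<le> k * (r + \<epsilon>)" using nq k by simp
    also have "\<dots> \<le> u \<bullet> q" using uq unfolding \<epsilon>_eq[symmetric] by linarith
    finally have "k \<le> u \<bullet> q / norm q" using \<open>0 < norm q\<close> by (simp add: field_simps)
    moreover have "u \<bullet> q / norm q \<le> 1"
      using \<open>0 < norm q\<close> norm_cauchy_schwarz[of u q] u by (simp add: field_simps)
    ultimately have "arccos (u \<bullet> q / norm q) \<le> arccos k"
      using k by (intro arccos_le_arccos) auto
    also have "\<dots> = \<theta> / 2" unfolding k_def using \<theta> by (intro arccos_cos) auto
    finally show "q \<in> truncated_cone s \<theta> u"
      using uq \<epsilon> r u by (simp add: truncated_cone_def vec_angle_def)
  qed
  with r \<epsilon> that show ?thesis by blast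
qed

section \<open>Supports of image measures and of marginals\<close>

text \<open>A closed set has full image measure exactly if its preimage, closed by continuity, has
  full measure under \<open>M\<close>. The closure is taken because \<open>f\<close> need not map
  closed sets to closed sets.\<close>

lemma supp_distr:
  fixes M :: "'a::second_countable_topology measure" and f :: "'a \<Rightarrow> 'b::topological_space"
  assumes M: "M \<in> borel_probs" and f: "continuous_on UNIV f"
  shows "supp (distr M borel f) = closure (f ` supp M)"
proof
  have sets: "sets M = sets borel" and "prob_space M" using M by (simp_all add: borel_probs_def)
  interpret prob_space M by fact
  have sp: "space M = UNIV" using sets_eq_imp_space_eq[OF sets] by simp
  have f_m: "f \<in> M \<rightarrow>\<^sub>M borel"
    unfolding measurable_cong_sets[OF sets refl] using f by (rule borel_measurable_continuous_onI)
  have distr: "emeasure (distr M borel f) C = emeasure M (f -` C)" if "closed C" for C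
    using that f_m by (simp add: emeasure_distr sp)
  have distr_space: "emeasure (distr M borel f) (space (distr M borel f)) = emeasure M (space M)"
    using distr[of UNIV] by (simp add: sp)
  show "supp (distr M borel f) \<subseteq> closure (f ` supp M)"
  proof (rule supp_minimal)
    have "closed (f -` closure (f ` supp M))"
      using f by (rule closed_vimage[rotated]) simp
    then have "emeasure M (supp M) \<le> emeasure M (f -` closure (f ` supp M))"
      using closure_subset[of "f ` supp M"] sets by (intro emeasure_mono) auto
    then show "emeasure (distr M borel f) (closure (f ` supp M))
        = emeasure (distr M borel f) (space (distr M borel f))"
      unfolding distr_space distr[OF closed_closure] emeasure_supp[OF M]
      by (intro antisym emeasure_space)
  qed simp
  show "closure (f ` supp M) \<subseteq> supp (distr M borel f)"
  proof (rule closure_minimal[OF _ closed_supp], unfold supp_def[of "distr M borel f"], intro Inter_greatest)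
    fix C assume "C \<in> {C. closed C \<and> emeasure (distr M borel f) C
      = emeasure (distr M borel f) (space (distr M borel f))}"
    then have "closed C" and "emeasure M (f -` C) = emeasure M (space M)"
      using distr distr_space by auto
    then have "supp M \<subseteq> f -` C"
      using f by (intro supp_minimal closed_vimage)
    then show "f ` supp M \<subseteq> C" by blast
  qed
qed

lemma supp_coupling:
  fixes \<mu> :: "'a::second_countable_topology measure" and \<nu> :: "'b::second_countable_topology measure"
  assumes "\<pi> \<in> couplings \<mu> \<nu>"
  shows "supp \<mu> = closure (fst ` supp \<pi>)" "supp \<nu> = closure (snd ` supp \<pi>)"
proof -
  have \<pi>: "\<pi> \<in> borel_probs" and "\<mu> = distr \<pi> borel fst" "\<nu> = distr \<pi> borel snd"
    using assms by (simp_all add: couplings_def)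
  then show "supp \<mu> = closure (fst ` supp \<pi>)" "supp \<nu> = closure (snd ` supp \<pi>)"
    using supp_distr[OF \<pi> continuous_on_fst[OF continuous_on_id]]
      supp_distr[OF \<pi> continuous_on_snd[OF continuous_on_id]] by simp_all
qed

section \<open>Escaping partners near a singular point\<close>

text \<open>If for some \<open>n\<close> every support point over the ball of radius
  \<open>1 / (n + 1)\<close> about \<open>x\<close> had a partner of norm at most \<open>n\<close>,
  then the part of \<open>supp \<nu>\<close> in the closed ball of radius \<open>n\<close> would be
  a compact set witnessing regularity at \<open>x\<close>. Euclidean structure is what makes that
  set compact.\<close>

lemma singular_point_sequence:
  fixes \<mu> :: "'a::{metric_space, second_countable_topology} measure"
    and \<nu> :: "'b::euclidean_space measure"
  assumes \<pi>: "\<pi> \<in> couplings \<mu> \<nu>" and x: "x \<in> singular_points \<mu> \<nu> \<pi>"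
  obtains X Y where "\<And>n. (X n, Y n) \<in> supp \<pi>" "X \<longlonglongrightarrow> x" "filterlim Y at_infinity sequentially"
proof -
  have "\<exists>z. z \<in> supp \<pi> \<and> dist (fst z) x < inverse (real (Suc n)) \<and> real n < norm (snd z)" for n
  proof (rule ccontr)
    assume *: "\<not> ?thesis"
    define U where "U = supp \<mu> \<inter> ball x (inverse (real (Suc n)))"
    define K where "K = supp \<nu> \<inter> cball 0 (real n)"
    have "compact K" unfolding K_def by (intro closed_Int_compact closed_supp) auto
    moreover have "fst ` supp \<pi> \<inter> U = fst ` (supp \<pi> \<inter> (U \<times> K))"
      using supp_coupling(2)[OF \<pi>] closure_subset[of "snd ` supp \<pi>"] *
      by (force simp: U_def K_def dist_commute)
    ultimately have "induces_regularity_on \<mu> \<nu> \<pi> U"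
      unfolding induces_regularity_on_def by (auto simp: U_def K_def)
    moreover have "x \<in> U" using x by (auto simp: U_def singular_points_def)
    ultimately show False using x by (auto simp: singular_points_def induces_regularity_at_def)
  qed
  then obtain Z where Z: "\<And>n. Z n \<in> supp \<pi>" "\<And>n. dist (fst (Z n)) x < inverse (real (Suc n))"
    "\<And>n. real n < norm (snd (Z n))" by metis
  show thesis
  proof
    show "(fst (Z n), snd (Z n)) \<in> supp \<pi>" for n using Z by simp
    have "(\<lambda>n. dist (fst (Z n)) x) \<longlonglongrightarrow> 0"
      by (rule tendsto_sandwich[OF _ _ tendsto_const LIMSEQ_inverse_real_of_nat])
        (intro always_eventually allI less_imp_le Z zero_le_dist)+
    then show "(\<lambda>n. fst (Z n)) \<longlonglongrightarrow> x" by (rule tendsto_dist_iff[THEN iffD2])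
    show "filterlim (\<lambda>n. snd (Z n)) at_infinity sequentially"
      by (rule filterlim_norm_at_top_imp_at_infinity, rule filterlim_at_top_mono[OF filterlim_real_sequentially])
        (auto intro!: always_eventually less_imp_le Z)
  qed
qed

section \<open>Excluding singular points in the interior of the support\<close>

theorem theorem4:
  fixes h :: "real ^ 'd \<Rightarrow> real"
    and c :: "(real ^ 'd) \<times> (real ^ 'd) \<Rightarrow> real"
    and \<mu> \<nu> :: "(real ^ 'd) measure"
    and \<pi> :: "((real ^ 'd) \<times> (real ^ 'd)) measure"
  assumes h_nonneg: "\<And>x. 0 \<le> h x"
    and h_cont: "continuous_on UNIV h"
    and c_def: "\<And>x y. c (x, y) = h (x - y)"
    and C: "\<exists>s \<theta>. 0 < s \<and> 0 < \<theta> \<and> \<theta> < pi \<and>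
      (\<forall>\<^sub>F p in at_infinity. \<exists>u. norm u = 1 \<and> (\<forall>q\<in>truncated_cone s \<theta> u. h (p + q) \<le> h p))"
    and G: "\<exists>\<delta> :: real ^ 'd \<Rightarrow> real ^ 'd.
      filterlim (\<lambda>x. h x - h (x + \<delta> x)) at_top at_infinity \<and> (\<delta> \<longlongrightarrow> 0) at_infinity"
    and \<mu>: "\<mu> \<in> borel_probs"
    and \<nu>: "\<nu> \<in> borel_probs"
    and finite_cost: "transport_cost c \<mu> \<nu> < \<infinity>"
    and optimal: "optimal_plan c \<mu> \<nu> \<pi>"
  shows "singular_points \<mu> \<nu> \<pi> \<subseteq> frontier (supp \<mu>)"
proof
  fix x assume sing: "x \<in> singular_points \<mu> \<nu> \<pi>"
  have coupling: "\<pi> \<in> couplings \<mu> \<nu>" using optimal by (simp add: optimal_plan_def)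
  have mono: "h (x - y) + h (x' - y') \<le> h (x - y') + h (x' - y)"
    if "(x, y) \<in> supp \<pi>" "(x', y') \<in> supp \<pi>" for x y x' y'
  proof -
    have "c = (\<lambda>z. h (fst z - snd z))" using c_def by auto
    then have "continuous_on UNIV c"
      by (auto intro!: continuous_intros continuous_on_compose2[OF h_cont])
    moreover have "0 \<le> c z" for z using c_def h_nonneg by (cases z) simp
    ultimately show ?thesis
      using optimal_plan_supp_monotone[OF _ _ finite_cost optimal that] by (simp add: c_def)
  qed
  obtain X Y where XY: "\<And>n. (X n, Y n) \<in> supp \<pi>" "X \<longlonglongrightarrow> x" "filterlim Y at_infinity sequentially"
    using singular_point_sequence[OF coupling sing] by blast
  show "x \<in> frontier (supp \<mu>)"
  proof (rule ccontr)
    assume "x \<notin> frontier (supp \<mu>)"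
    moreover have "x \<in> supp \<mu>" using sing by (simp add: singular_points_def)
    ultimately have "x \<in> interior (supp \<mu>)"
      using closure_subset by (auto simp: frontier_def)
    then obtain R where R: "0 < R" "ball x R \<subseteq> supp \<mu>" by (auto simp: mem_interior)
    obtain s \<theta> where s\<theta>: "0 < s" "0 < \<theta>" "\<theta> < pi"
      and C': "\<forall>\<^sub>F p in at_infinity. \<exists>u. norm u = 1 \<and> (\<forall>q\<in>truncated_cone s \<theta> u. h (p + q) \<le> h p)"
      using C by blast
    obtain \<delta> :: "real ^ 'd \<Rightarrow> real ^ 'd" where
      \<delta>: "filterlim (\<lambda>x. h x - h (x + \<delta> x)) at_top at_infinity" "(\<delta> \<longlongrightarrow> 0) at_infinity"
      using G by blast
    obtain r \<epsilon> where r: "0 < r" "r < R" "0 < \<epsilon>"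
      and cone: "\<And>u :: real ^ 'd. norm u = 1 \<Longrightarrow> ball (r *\<^sub>R u) \<epsilon> \<subseteq> truncated_cone s \<theta> u"
      using truncated_cone_contains_ball[OF s\<theta> R(1), where 'a = "real ^ 'd"] by blast
    define p where "p = (\<lambda>n. X n - Y n)"
    have p: "filterlim p at_infinity sequentially"
      using tendsto_add_filterlim_at_infinity[OF XY(2), of "\<lambda>n. - Y n"] XY(3)
      by (simp add: p_def filterlim_at_infinity_conv_norm_at_top)
    have \<delta>p: "(\<lambda>n. \<delta> (p n)) \<longlonglongrightarrow> 0" using \<delta>(2) p by (rule filterlim_compose)
    \<comment> \<open>The shift by \<open>\<delta> (p n)\<close> vanishes in the limit, so condition
      (C) is available at the shifted points too.\<close>
    have p': "filterlim (\<lambda>n. p n + \<delta> (p n)) at_infinity sequentially"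
      using tendsto_add_filterlim_at_infinity[OF \<delta>p p] by (simp add: add.commute)
    have "\<forall>\<^sub>F n in sequentially. \<exists>u. norm u = 1 \<and>
        (\<forall>q\<in>truncated_cone s \<theta> u. h (p n + \<delta> (p n) + q) \<le> h (p n + \<delta> (p n)))"
      using eventually_compose_filterlim[OF C' p'] .
    then obtain N u where u: "\<And>n. n \<ge> N \<Longrightarrow> norm (u n) = 1"
      and uC: "\<And>n q. n \<ge> N \<Longrightarrow> q \<in> truncated_cone s \<theta> (u n) \<Longrightarrow> h (p n + \<delta> (p n) + q) \<le> h (p n + \<delta> (p n))"
      unfolding eventually_sequentially by metis
    \<comment> \<open>The directions are unit vectors only from \<open>N\<close> on; shifting the
      index puts the whole sequence on the compact sphere.\<close>
    have "\<forall>n. u (n + N) \<in> sphere 0 1" using u by simp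
    then obtain e \<sigma> where e: "e \<in> sphere 0 1" "strict_mono \<sigma>" "((\<lambda>n. u (n + N)) \<circ> \<sigma>) \<longlonglongrightarrow> e"
      using compact_sphere[of "0 :: real ^ 'd" 1, unfolded compact_def, rule_format, of "\<lambda>n. u (n + N)"]
      by auto
    define \<tau> where "\<tau> = (\<lambda>n. \<sigma> n + N)"
    have \<tau>: "filterlim \<tau> at_top sequentially"
      unfolding \<tau>_def using filterlim_subseq[OF e(2)]
      by (rule filterlim_at_top_mono) auto
    have u\<tau>: "(\<lambda>n. u (\<tau> n)) \<longlonglongrightarrow> e" using e(3) by (simp add: \<tau>_def comp_def)
    \<comment> \<open>The centre of the limiting ball has distance \<open>r < R\<close> from
      \<open>x\<close>. This is where interiority of \<open>x\<close> enters.\<close>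
    have "x + r *\<^sub>R e \<in> supp \<mu>" using R r e(1) by (auto simp: dist_norm)
    \<comment> \<open>The point \<open>x + r *\<^sub>R e\<close> itself may have no partner, because
      \<open>supp \<mu>\<close> is only the closure of the projected support; some point within
      \<open>\<epsilon>\<close> of it has one.\<close>
    then obtain x' y' where x'y': "(x', y') \<in> supp \<pi>" "x' \<in> ball (x + r *\<^sub>R e) \<epsilon>"
      using r(3) unfolding supp_coupling(1)[OF coupling] closure_approachable
      by (force simp: dist_commute)
    have X\<tau>: "(\<lambda>n. X (\<tau> n)) \<longlonglongrightarrow> x" using XY(2) \<tau> by (rule filterlim_compose)
    have \<delta>\<tau>: "(\<lambda>n. \<delta> (p (\<tau> n))) \<longlonglongrightarrow> 0" using \<delta>p \<tau> by (rule filterlim_compose)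
    \<comment> \<open>\<open>q n\<close> is the displacement that carries
      \<open>p (\<tau> n) + \<delta> (p (\<tau> n))\<close> to \<open>x' - Y (\<tau> n)\<close>. It
      tends to \<open>x' - x\<close>, which lies strictly inside the ball about
      \<open>r *\<^sub>R e\<close>, so eventually \<open>q n\<close> lies in the ball about
      \<open>r *\<^sub>R u (\<tau> n)\<close>.\<close>
    define q where "q = (\<lambda>n. x' - X (\<tau> n) - \<delta> (p (\<tau> n)))"
    have "(\<lambda>n. norm (r *\<^sub>R u (\<tau> n) - q n)) \<longlonglongrightarrow> norm (r *\<^sub>R e - (x' - x - 0))"
      unfolding q_def by (intro tendsto_intros u\<tau> X\<tau> \<delta>\<tau>)
    moreover have "norm (r *\<^sub>R e - (x' - x - 0)) < \<epsilon>"
      using x'y'(2) by (simp add: dist_norm algebra_simps)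
    ultimately have "\<forall>\<^sub>F n in sequentially. norm (r *\<^sub>R u (\<tau> n) - q n) < \<epsilon>"
      by (rule order_tendstoD)
    then have "\<forall>\<^sub>F n in sequentially. h (x' - Y (\<tau> n)) \<le> h (p (\<tau> n) + \<delta> (p (\<tau> n)))"
    proof (eventually_elim)
      case (elim n)
      have "N \<le> \<tau> n" by (simp add: \<tau>_def)
      then have "q n \<in> truncated_cone s \<theta> (u (\<tau> n))"
        using cone[OF u] elim by (auto simp: dist_norm subset_iff)
      from uC[OF \<open>N \<le> \<tau> n\<close> this] show ?case by (simp add: q_def p_def algebra_simps)
    qed
    \<comment> \<open>Monotonicity for \<open>(X (\<tau> n), Y (\<tau> n))\<close> and
      \<open>(x', y')\<close> bounds \<open>h (p (\<tau> n)) - h (x' - Y (\<tau> n))\<close> by the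
      right-hand side, and the previous estimate replaces the subtracted term by a larger
      one.\<close>
    then have ev: "\<forall>\<^sub>F n in sequentially. h (p (\<tau> n)) - h (p (\<tau> n) + \<delta> (p (\<tau> n)))
        \<le> h (X (\<tau> n) - y') - h (x' - y')"
    proof (eventually_elim)
      case (elim n)
      with mono[OF XY(1) x'y'(1), of "\<tau> n"] show ?case by (simp add: p_def)
    qed
    \<comment> \<open>By (G) the left side of \<open>ev\<close> diverges, whereas its right side
      converges because \<open>x'\<close> and \<open>y'\<close> are fixed and \<open>h\<close> is
      continuous.\<close>
    have "filterlim (\<lambda>n. h (p (\<tau> n)) - h (p (\<tau> n) + \<delta> (p (\<tau> n)))) at_top sequentially"
      by (rule filterlim_compose[OF \<delta>(1)], rule filterlim_compose[OF p \<tau>])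
    then have "filterlim (\<lambda>n. h (X (\<tau> n) - y') - h (x' - y')) at_top sequentially"
      using ev by (rule filterlim_at_top_mono)
    moreover have "(\<lambda>n. h (X (\<tau> n) - y') - h (x' - y')) \<longlonglongrightarrow> h (x - y') - h (x' - y')"
      by (intro tendsto_intros continuous_on_tendsto_compose[OF h_cont] X\<tau>) auto
    ultimately show False
      using not_tendsto_and_filterlim_at_infinity filterlim_at_top_imp_at_infinity sequentially_bot by blast
  qed
qed
end
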